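(* Let $X\subseteq V$ with $d^*(X)>0$. For each $k>0$ and each $\mathbf{r}\in \mathbb{N}^k$ there exists a constant $K=K(X,k,\mathbf{r})>0$ such that $X$ contains a balanced $(k,\mathbf{t},\mathbf{r})$-star for all sequences $\mathbf{t}=(t_i)_{i=1}^k\in\mathbb{M}^k$ with $t_1>K$.
   Context: Let $T_q$ be the homogeneous tree of degree $q+1\geq 3$ with vertex set $V$, graph metric $d$, and fixed root $o\in V$. For $n\geq 0$ let $S_n=\{y\in V\mid d(o,y)=n\}$. The (upper) density of $X\subseteq V$ is $d^*(X)=\limsup_{n\to\infty}|X\cap S_n|/|S_n|$. For $k>0$, $\mathbb{M}^k$ denotes the set of strictly monotone increasing sequences of $k$ positive integers. For $\mathbf{t}=(t_i)_{i=1}^k\in\mathbb{M}^k$ and $\mathbf{r}=(r_i)_{i=1}^k\in\mathbb{N}^k$, a $(k,\mathbf{t},\mathbf{r})$-star is a set $Y$ of vertices of $T_q$ with a distinguished vertex $v_0\in Y$ (the centre) such that (1) if $v\in Y$ then $d(v_0,v)\in\{2t_1,\ldots,2t_k\}$, and (2) for each $1\leq i\leq k$, $|\{v\in Y\mid d(v_0,v)=2t_i\}|=r_i$. The star is balanced if $d(o,x)$ is constant for all $x\in Y$.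
   Formalization: Condition (1) in the definition of a star is imposed only on vertices of Y other than the centre, since the centre has distance 0 from itself and, taken literally, the condition would rule out every star. *)

theory Defs
  imports Complex_Main "HOL-Library.Extended_Real"
begin

text \<open>
  Undirected simple graphs, possibly infinite, are given by a vertex set \<open>V\<close> and a symmetric
  irreflexive adjacency relation \<open>E\<close> on \<open>V\<close>.
\<close>

definition simple_graph :: "'a set \<Rightarrow> ('a \<Rightarrow> 'a \<Rightarrow> bool) \<Rightarrow> bool" where
  "simple_graph V E \<longleftrightarrow>
     (\<forall>u v. E u v \<longrightarrow> u \<in> V \<and> v \<in> V \<and> u \<noteq> v \<and> E v u)"

definition walk_betw :: "'a set \<Rightarrow> ('a \<Rightarrow> 'a \<Rightarrow> bool) \<Rightarrow> 'a \<Rightarrow> 'a list \<Rightarrow> 'a \<Rightarrow> bool" where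
  "walk_betw V E u xs v \<longleftrightarrow>
     xs \<noteq> [] \<and> set xs \<subseteq> V \<and> successively E xs \<and> hd xs = u \<and> last xs = v"

definition connected_graph :: "'a set \<Rightarrow> ('a \<Rightarrow> 'a \<Rightarrow> bool) \<Rightarrow> bool" where
  "connected_graph V E \<longleftrightarrow> (\<forall>u\<in>V. \<forall>v\<in>V. \<exists>xs. walk_betw V E u xs v)"

definition graph_cycle :: "'a set \<Rightarrow> ('a \<Rightarrow> 'a \<Rightarrow> bool) \<Rightarrow> 'a list \<Rightarrow> bool" where
  "graph_cycle V E xs \<longleftrightarrow>
     3 \<le> length xs \<and> distinct xs \<and> set xs \<subseteq> V \<and> successively E xs \<and> E (last xs) (hd xs)"

definition graph_tree :: "'a set \<Rightarrow> ('a \<Rightarrow> 'a \<Rightarrow> bool) \<Rightarrow> bool" where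
  "graph_tree V E \<longleftrightarrow>
     simple_graph V E \<and> connected_graph V E \<and> (\<nexists>xs. graph_cycle V E xs)"

text \<open>
  Since \<open>q + 1\<close> is positive, the cardinality condition also forces the neighbourhoods to be finite.
\<close>

definition homogeneous_tree :: "nat \<Rightarrow> 'a set \<Rightarrow> ('a \<Rightarrow> 'a \<Rightarrow> bool) \<Rightarrow> bool" where
  "homogeneous_tree q V E \<longleftrightarrow>
     graph_tree V E \<and> (\<forall>v\<in>V. card {w. E v w} = q + 1)"

text \<open>A walk along \<open>n\<close> edges visits \<open>n + 1\<close> vertices.\<close>

definition graph_dist :: "'a set \<Rightarrow> ('a \<Rightarrow> 'a \<Rightarrow> bool) \<Rightarrow> 'a \<Rightarrow> 'a \<Rightarrow> nat" where
  "graph_dist V E u v = (LEAST n. \<exists>xs. walk_betw V E u xs v \<and> length xs = n + 1)"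

definition graph_sphere :: "'a set \<Rightarrow> ('a \<Rightarrow> 'a \<Rightarrow> bool) \<Rightarrow> 'a \<Rightarrow> nat \<Rightarrow> 'a set" where
  "graph_sphere V E x n = {y \<in> V. graph_dist V E x y = n}"

definition upper_density :: "'a set \<Rightarrow> ('a \<Rightarrow> 'a \<Rightarrow> bool) \<Rightarrow> 'a \<Rightarrow> 'a set \<Rightarrow> ereal" where
  "upper_density V E x X =
     limsup (\<lambda>n. ereal (real (card (X \<inter> graph_sphere V E x n)) / real (card (graph_sphere V E x n))))"

text \<open>
  Sequences of length \<open>k\<close> are lists of length \<open>k\<close>; the entry with index \<open>i\<close> in the usual
  numbering from \<open>1\<close> is \<open>t ! (i - 1)\<close>.
\<close>

definition incr_seqs :: "nat \<Rightarrow> nat list set" where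
  "incr_seqs k = {t. length t = k \<and> sorted_wrt (<) t \<and> (\<forall>x \<in> set t. 0 < x)}"

text \<open>
  The distance condition is imposed on the vertices of \<open>Y\<close> other than the centre, which has
  distance \<open>0\<close> from itself. Finiteness is required explicitly because \<open>card\<close> of an infinite set
  is \<open>0\<close>.
\<close>

definition is_star ::
    "'a set \<Rightarrow> ('a \<Rightarrow> 'a \<Rightarrow> bool) \<Rightarrow> nat \<Rightarrow> nat list \<Rightarrow> nat list \<Rightarrow> 'a set \<Rightarrow> 'a \<Rightarrow> bool" where
  "is_star V E k t r Y v0 \<longleftrightarrow>
     Y \<subseteq> V \<and> v0 \<in> Y \<and>
     (\<forall>v \<in> Y - {v0}. graph_dist V E v0 v \<in> {2 * t ! i |i. i < k}) \<and>
     (\<forall>i<k. finite {v \<in> Y. graph_dist V E v0 v = 2 * t ! i} \<and>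
            card {v \<in> Y. graph_dist V E v0 v = 2 * t ! i} = r ! i)"

definition balanced :: "'a set \<Rightarrow> ('a \<Rightarrow> 'a \<Rightarrow> bool) \<Rightarrow> 'a \<Rightarrow> 'a set \<Rightarrow> bool" where
  "balanced V E x Y \<longleftrightarrow> (\<exists>n. \<forall>y\<in>Y. graph_dist V E x y = n)"

end

theory Submission
  imports Defs
begin

text \<open>
  If no \<open>K\<close> works, there are arbitrarily many sequences \<open>t\<close> without stars that occupy pairwise
  disjoint blocks of heights, all starting beyond any given bound. Take a sphere \<open>S n\<close> of large
  radius in which \<open>X\<close> has density at least \<open>\<delta>\<close>. Points of \<open>S n\<close> whose paths towards the root first
  meet at height \<open>s\<close> have distance \<open>2 s\<close>. Hence in each block every \<open>x \<in> X \<inter> S n\<close> has a height \<open>s\<close>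
  at which fewer than \<open>R\<close> points of \<open>X \<inter> S n\<close> branch off. If the ancestor \<open>a\<close> of \<open>x\<close> at height \<open>s\<close>
  has at least \<open>2 R\<close> points of \<open>X \<inter> S n\<close> below it, then all such \<open>x\<close> below \<open>a\<close> lie below a single
  child of \<open>a\<close>; the remaining \<open>x\<close> have density \<open>O(R / q ^ s)\<close>. A uniformly chosen path follows a
  distinguished child somewhere in a given block of \<open>k\<close> heights with probability at most
  \<open>1 - (1 - 1 / q) ^ k\<close>, independently of the higher blocks, so \<open>J\<close> blocks force the density of \<open>X\<close>
  in \<open>S n\<close> below \<open>\<delta>\<close>.
\<close>

section \<open>Non-backtracking walks and distances in a tree\<close>

text \<open>Non-backtracking walks: \<open>n\<close> counts edges, and \<open>p\<close> is unconstrained beyond \<open>n\<close>.\<close>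

definition nb_walk :: "('a \<Rightarrow> 'a \<Rightarrow> bool) \<Rightarrow> (nat \<Rightarrow> 'a) \<Rightarrow> nat \<Rightarrow> bool" where
  "nb_walk E p n \<longleftrightarrow> (\<forall>i<n. E (p i) (p (Suc i))) \<and> (\<forall>i. Suc (Suc i) \<le> n \<longrightarrow> p i \<noteq> p (Suc (Suc i)))"

text \<open>A repetition with \<open>j - i\<close> minimal would close a cycle: the vertices in
  between are distinct by induction, irreflexivity excludes length 1, and the absence of
  backtracking excludes length 2.\<close>

lemma nb_walk_inj:
  assumes sg: "simple_graph V E" and ac: "\<nexists>xs. graph_cycle V E xs"
    and nb: "nb_walk E p n" and "i < j" "j \<le> n"
  shows "p i \<noteq> p j"
  using \<open>i < j\<close> \<open>j \<le> n\<close>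
proof (induction "j - i" arbitrary: i j rule: less_induct)
  case less
  have E: "E (p l) (p (Suc l))" if "l < n" for l using nb that by (simp add: nb_walk_def)
  have inV: "p l \<in> V" if "l < n" for l using E[OF that] sg unfolding simple_graph_def by blast
  show ?case
  proof
    assume eq: "p i = p j"
    have "j \<noteq> Suc i" using E[of i] eq less.prems sg unfolding simple_graph_def by auto
    moreover have "j \<noteq> Suc (Suc i)" using nb eq less.prems unfolding nb_walk_def by auto
    ultimately have len: "3 \<le> j - i" using less.prems by linarith
    let ?c = "map p [i..<j]"
    have "inj_on p {i..<j}"
    proof (rule linorder_inj_onI)
      fix x y assume "x < y" "x \<in> {i..<j}" "y \<in> {i..<j}"
      then show "p x \<noteq> p y" using less.hyps[of y x] less.prems by auto
    qed auto
    then have "distinct ?c" by (simp add: distinct_map)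
    moreover have "set ?c \<subseteq> V" using inV less.prems by auto
    moreover have "successively E ?c"
      unfolding successively_conv_nth using E less.prems by auto
    moreover have "E (last ?c) (hd ?c)"
    proof -
      have "last ?c = p (j - 1)" "hd ?c = p i" using less.prems by (simp_all add: last_map hd_map)
      then show ?thesis using E[of "j - 1"] eq less.prems by auto
    qed
    ultimately have "graph_cycle V E ?c" using len unfolding graph_cycle_def by simp
    then show False using ac by blast
  qed
qed

text \<open>Common first steps are stripped off by induction. Where the walks part, going back along
  \<open>p\<close> and then along \<open>p'\<close> gives a closed non-backtracking walk, which
  \<open>nb_walk_inj\<close> forbids.\<close>

lemma nb_walk_length_unique:
  assumes sg: "simple_graph V E" and ac: "\<nexists>xs. graph_cycle V E xs"
    and "nb_walk E p m" "nb_walk E p' m'" "p 0 = p' 0" "p m = p' m'"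
  shows "m = m'"
  using assms(3-6)
proof (induction m arbitrary: p p' m')
  case 0
  then show ?case using nb_walk_inj[OF sg ac, of p' m' 0 m'] by auto
next
  case (Suc m)
  show ?case
  proof (cases m')
    case 0
    then show ?thesis using nb_walk_inj[OF sg ac, of p "Suc m" 0 "Suc m"] Suc.prems by auto
  next
    case (Suc l)
    show ?thesis
    proof (cases "p 1 = p' 1")
      case True
      have "m = l"
        by (rule Suc.IH[of "\<lambda>i. p (Suc i)" "\<lambda>i. p' (Suc i)"])
          (use Suc.prems Suc True in \<open>auto simp: nb_walk_def\<close>)
      then show ?thesis using Suc by simp
    next
      case False
      let ?n = "Suc m"
      \<comment> \<open>The two walks are joined at index \<open>?n\<close>, at the vertex
        \<open>p 0 = p' 0\<close>; since \<open>p 1\<close> and \<open>p' 1\<close> differ, there is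
        no backtrack at the junction.\<close>
      define g where "g i = (if i \<le> ?n then p (?n - i) else p' (i - ?n))" for i
      have sym: "E a b \<Longrightarrow> E b a" for a b using sg unfolding simple_graph_def by blast
      have "E (g i) (g (Suc i))" if "i < ?n + m'" for i
      proof -
        consider "i < ?n" | "i = ?n" | "i > ?n" by linarith
        then show ?thesis
        proof cases
          case 1
          then have "?n - i = Suc (?n - Suc i)" "?n - Suc i < ?n" by auto
          moreover have "E (p (?n - Suc i)) (p (Suc (?n - Suc i)))"
            using Suc.prems(1) \<open>?n - Suc i < ?n\<close> unfolding nb_walk_def by blast
          ultimately show ?thesis using 1 sym[of "g (Suc i)" "g i"] by (simp add: g_def)
        next
          case 2
          have "E (p' 0) (p' (Suc 0))" using Suc.prems(2) Suc by (simp add: nb_walk_def)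
          then show ?thesis using 2 Suc.prems(3) by (simp add: g_def)
        next
          case 3
          then have "Suc i - ?n = Suc (i - ?n)" "i - ?n < m'" using that by auto
          then show ?thesis using 3 Suc.prems(2) by (simp add: g_def nb_walk_def)
        qed
      qed
      moreover have "g i \<noteq> g (Suc (Suc i))" if "Suc (Suc i) \<le> ?n + m'" for i
      proof -
        consider "Suc (Suc i) \<le> ?n" | "Suc i = ?n" | "i = ?n" | "i > ?n" by linarith
        then show ?thesis
        proof cases
          case 1
          then have "?n - i = Suc (Suc (?n - Suc (Suc i)))" by auto
          moreover have "p (?n - Suc (Suc i)) \<noteq> p (Suc (Suc (?n - Suc (Suc i))))"
            using Suc.prems(1) 1 unfolding nb_walk_def by simp
          ultimately show ?thesis using 1 by (simp add: g_def)
        next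
          case 2
          then show ?thesis using False by (simp add: g_def)
        next
          case 3
          have "p' 0 \<noteq> p' (Suc (Suc 0))" using Suc.prems(2) that 3 unfolding nb_walk_def by auto
          then show ?thesis using 3 Suc.prems(3) by (simp add: g_def numeral_2_eq_2)
        next
          case 4
          then have "Suc (Suc i) - ?n = Suc (Suc (i - ?n))" "Suc (Suc (i - ?n)) \<le> m'"
            using that by auto
          then show ?thesis using 4 Suc.prems(2) by (simp add: g_def nb_walk_def)
        qed
      qed
      ultimately have "nb_walk E g (?n + m')" by (simp add: nb_walk_def)
      moreover have "g 0 = g (?n + m')" using Suc.prems(4) Suc by (simp add: g_def)
      ultimately show ?thesis using nb_walk_inj[OF sg ac, of g "?n + m'" 0 "?n + m'"] by auto
    qed
  qed
qed

lemma walk_betw_iff_fun: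
  assumes sg: "simple_graph V E" and u: "u \<in> V"
  shows "(\<exists>xs. walk_betw V E u xs v \<and> length xs = n + 1) \<longleftrightarrow>
    (\<exists>p. p 0 = u \<and> p n = v \<and> (\<forall>i<n. E (p i) (p (Suc i))))"
proof
  assume "\<exists>xs. walk_betw V E u xs v \<and> length xs = n + 1"
  then obtain xs where xs: "walk_betw V E u xs v" "length xs = n + 1" by blast
  then have "xs ! 0 = u" "xs ! n = v" "\<forall>i<n. E (xs ! i) (xs ! Suc i)"
    by (auto simp: walk_betw_def hd_conv_nth last_conv_nth successively_conv_nth)
  then show "\<exists>p. p 0 = u \<and> p n = v \<and> (\<forall>i<n. E (p i) (p (Suc i)))" by (intro exI[of _ "(!) xs"]) auto
next
  assume "\<exists>p. p 0 = u \<and> p n = v \<and> (\<forall>i<n. E (p i) (p (Suc i)))"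
  then obtain p where p: "p 0 = u" "p n = v" "\<forall>i<n. E (p i) (p (Suc i))" by blast
  have "p i \<in> V" if "i \<le> n" for i
  proof (cases i)
    case (Suc l)
    then have "E (p l) (p i)" using p(3) that by simp
    then show ?thesis using sg unfolding simple_graph_def by blast
  qed (use p(1) u in simp)
  then have "set (map p [0..<n+1]) \<subseteq> V" by auto
  moreover have "successively E (map p [0..<n+1])"
    unfolding successively_conv_nth using p(3) by (auto simp del: upt_Suc)
  moreover have "hd (map p [0..<n+1]) = u" using p(1) by (simp add: hd_map del: upt_Suc)
  moreover have "last (map p [0..<n+1]) = v" using p(2) by simp
  ultimately have "walk_betw V E u (map p [0..<n+1]) v" unfolding walk_betw_def by simp
  then show "\<exists>xs. walk_betw V E u xs v \<and> length xs = n + 1"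
    by (intro exI[of _ "map p [0..<n+1]"]) simp
qed

text \<open>A shortest walk does not backtrack, since cutting out a step forth and back would save
  two edges.\<close>

lemma exists_geodesic:
  assumes "graph_tree V E" and u: "u \<in> V" and v: "v \<in> V"
  obtains p where "nb_walk E p (graph_dist V E u v)" "p 0 = u" "p (graph_dist V E u v) = v"
proof -
  have sg: "simple_graph V E" and con: "connected_graph V E"
    using assms(1) by (auto simp: graph_tree_def)
  let ?W = "\<lambda>n. \<exists>p. p 0 = u \<and> p n = v \<and> (\<forall>i<n. E (p i) (p (Suc i)))"
  have d: "graph_dist V E u v = (LEAST n. ?W n)"
    unfolding graph_dist_def walk_betw_iff_fun[OF sg u] ..
  obtain xs where xs: "walk_betw V E u xs v" using con u v unfolding connected_graph_def by blast
  then have "length xs = (length xs - 1) + 1" unfolding walk_betw_def by (cases xs) auto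
  with xs have "?W (length xs - 1)" using walk_betw_iff_fun[OF sg u] by blast
  then have "?W (graph_dist V E u v)" unfolding d by (rule LeastI)
  then obtain p where p: "p 0 = u" "p (graph_dist V E u v) = v"
    "\<forall>i<graph_dist V E u v. E (p i) (p (Suc i))" by blast
  let ?n = "graph_dist V E u v"
  have "p i \<noteq> p (Suc (Suc i))" if i: "Suc (Suc i) \<le> ?n" for i
  proof
    assume eq: "p i = p (Suc (Suc i))"
    define g where "g l = (if l \<le> i then p l else p (Suc (Suc l)))" for l
    have "g 0 = u" using p by (simp add: g_def)
    \<comment> \<open>If the backtrack is at the very end, the shortened walk stops at
      \<open>p i\<close>, which equals \<open>v\<close> by \<open>eq\<close>.\<close>
    moreover have "g (?n - 2) = v"
    proof (cases "?n - 2 \<le> i")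
      case True
      then have "?n = Suc (Suc i)" using i by linarith
      then show ?thesis using p(2) eq by (simp add: g_def)
    next
      case False
      then have "Suc (Suc (?n - 2)) = ?n" by linarith
      with False show ?thesis using p(2) by (simp add: g_def)
    qed
    moreover have "E (g l) (g (Suc l))" if "l < ?n - 2" for l
    proof -
      consider "Suc l \<le> i" | "l = i" | "l > i" by linarith
      then show ?thesis
      proof cases
        case 2
        then have "E (p (Suc (Suc i))) (p (Suc (Suc (Suc i))))" using p(3) that by auto
        then show ?thesis using 2 eq by (simp add: g_def)
      qed (use p(3) that in \<open>auto simp: g_def\<close>)
    qed
    ultimately have "?W (?n - 2)" by blast
    then have "?n \<le> ?n - 2" unfolding d by (rule Least_le)
    then show False using i by simp
  qed
  then have "nb_walk E p ?n" using p(3) by (simp add: nb_walk_def)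
  with p that show ?thesis by blast
qed

text \<open>By uniqueness of lengths every non-backtracking walk is as long as a geodesic with the
  same ends. A distance can therefore be found by exhibiting any such walk.\<close>

lemma graph_dist_nb_walk:
  assumes "graph_tree V E" and "p 0 \<in> V" "p n \<in> V" and "nb_walk E p n"
  shows "graph_dist V E (p 0) (p n) = n"
proof -
  obtain g where "nb_walk E g (graph_dist V E (p 0) (p n))" "g 0 = p 0"
    "g (graph_dist V E (p 0) (p n)) = p n"
    using exists_geodesic[OF assms(1-3)] by blast
  then show ?thesis
    using nb_walk_length_unique[of V E g _ p n] assms by (auto simp: graph_tree_def)
qed

section \<open>Depth, parents and spheres in the rooted tree\<close>

locale rooted_tree =
  fixes q :: nat and V :: "'a set" and E :: "'a \<Rightarrow> 'a \<Rightarrow> bool" and origin :: 'a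
  assumes hom: "homogeneous_tree q V E" and q: "q \<ge> 2" and origin: "origin \<in> V"
begin

abbreviation dep where "dep x \<equiv> graph_dist V E origin x"

abbreviation S where "S n \<equiv> graph_sphere V E origin n"

text \<open>A junk value at the root, which has no parent.\<close>

definition par where "par x = (SOME y. E y x \<and> Suc (dep y) = dep x)"

abbreviation anc where "anc h x \<equiv> (par ^^ h) x"

lemma tree: "graph_tree V E" using hom by (simp add: homogeneous_tree_def)

lemma E_sym: "E u v \<Longrightarrow> E v u" and E_left: "E u v \<Longrightarrow> u \<in> V"
  and E_right: "E u v \<Longrightarrow> v \<in> V"
  using tree unfolding graph_tree_def simple_graph_def by blast+

lemma dep_origin: "dep origin = 0"
  using graph_dist_nb_walk[OF tree, of "\<lambda>_. origin" 0] origin by (simp add: nb_walk_def)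

lemma dep_eq_0: assumes "x \<in> V" "dep x = 0" shows "x = origin"
proof -
  obtain p where "p 0 = origin" "p (dep x) = x"
    using exists_geodesic[OF tree origin assms(1)] by blast
  then show ?thesis using assms(2) by simp
qed

text \<open>\<open>y\<close> is the last vertex before \<open>x\<close> on a geodesic from the root.
  Appending any other neighbour of \<open>x\<close> to this geodesic creates no backtrack, so that
  neighbour is one step deeper.\<close>

lemma dep_neighbour_cases:
  assumes x: "x \<in> V" "x \<noteq> origin"
  obtains y where "E y x" "Suc (dep y) = dep x" "\<And>w. E x w \<Longrightarrow> w \<noteq> y \<Longrightarrow> dep w = Suc (dep x)"
proof -
  obtain p where p: "nb_walk E p (dep x)" "p 0 = origin" "p (dep x) = x"
    using exists_geodesic[OF tree origin x(1)] by blast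
  have "dep x \<noteq> 0" using dep_eq_0 x by blast
  then obtain m where m: "dep x = Suc m" using not0_implies_Suc by blast
  have E: "E (p m) x" using p m unfolding nb_walk_def by auto
  have "nb_walk E p m" using p(1) m by (simp add: nb_walk_def)
  then have "dep (p m) = m"
    using graph_dist_nb_walk[OF tree, of p m] p(2) origin E_left[OF E] by simp
  moreover have "dep w = Suc (dep x)" if w: "E x w" "w \<noteq> p m" for w
  proof -
    let ?g = "\<lambda>i. if i \<le> dep x then p i else w"
    have "E (?g i) (?g (Suc i))" if "i < Suc (dep x)" for i
      using that p w unfolding nb_walk_def by (cases "i = dep x") auto
    moreover have "?g i \<noteq> ?g (Suc (Suc i))" if "Suc (Suc i) \<le> Suc (dep x)" for i
      using that p(1) w(2) m unfolding nb_walk_def by (cases "i = m") auto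
    ultimately have "nb_walk E ?g (Suc (dep x))" by (simp add: nb_walk_def)
    then show ?thesis
      using graph_dist_nb_walk[OF tree, of ?g "Suc (dep x)"] p(2) origin E_right[OF w(1)] by simp
  qed
  ultimately show ?thesis using that[of "p m"] E m by simp
qed

lemma par:
  assumes "x \<in> V" "x \<noteq> origin"
  shows E_par: "E (par x) x" and dep_par: "Suc (dep (par x)) = dep x"
    and par_in_V: "par x \<in> V"
    and dep_neighbour: "E x w \<Longrightarrow> w \<noteq> par x \<Longrightarrow> dep w = Suc (dep x)"
proof -
  obtain y where y: "E y x" "Suc (dep y) = dep x" "\<And>w. E x w \<Longrightarrow> w \<noteq> y \<Longrightarrow> dep w = Suc (dep x)"
    using dep_neighbour_cases[OF assms] by blast
  have *: "E (par x) x \<and> Suc (dep (par x)) = dep x"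
    unfolding par_def by (rule someI[of _ y]) (use y in auto)
  then show "E (par x) x" "Suc (dep (par x)) = dep x" "par x \<in> V" using E_left by blast+
  \<comment> \<open>All other neighbours of \<open>x\<close> lie deeper, so the choice in
    \<open>par\<close> has a single candidate.\<close>
  have "par x = y" using y(3)[of "par x"] * E_sym[of "par x" x] by auto
  then show "E x w \<Longrightarrow> w \<noteq> par x \<Longrightarrow> dep w = Suc (dep x)" using y(3) by auto
qed

lemma par_unique:
  assumes "E x w" "dep w = Suc (dep x)" shows "par w = x"
proof -
  have "w \<in> V" "w \<noteq> origin" using E_right[OF assms(1)] assms(2) dep_origin by auto
  then show ?thesis using dep_neighbour[of w x] assms E_sym[of x w] by auto
qed

lemma S_D: "x \<in> S n \<Longrightarrow> x \<in> V" "x \<in> S n \<Longrightarrow> dep x = n" "x \<in> S (Suc n) \<Longrightarrow> x \<noteq> origin"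
  using dep_origin by (auto simp: graph_sphere_def)

lemma S_iff: "x \<in> S n \<longleftrightarrow> x \<in> V \<and> dep x = n" by (simp add: graph_sphere_def)

lemma par_S: "x \<in> S (Suc n) \<Longrightarrow> par x \<in> S n"
  using par_in_V[of x] dep_par[of x] S_D(3)[of x n] by (simp add: S_iff)

lemma anc_S: "x \<in> S n \<Longrightarrow> h \<le> n \<Longrightarrow> anc h x \<in> S (n - h)"
proof (induction h)
  case (Suc h)
  then have "anc h x \<in> S (Suc (n - Suc h))" by (simp add: Suc_diff_Suc)
  then show ?case using par_S by simp
qed simp

text \<open>All neighbours except the parent are children. The bound on \<open>m\<close> excludes
  the root, which has \<open>q + 1\<close> children.\<close>

lemma card_children:
  assumes "a \<in> S m" "m \<ge> 1"
  shows "card {w \<in> S (Suc m). par w = a} = q"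
proof -
  have a: "a \<in> V" "dep a = m" "a \<noteq> origin" using assms dep_origin by (auto simp: S_iff)
  have "{w \<in> S (Suc m). par w = a} = {w. E a w} - {par a}"
  proof (intro set_eqI iffI)
    fix w assume w: "w \<in> {w \<in> S (Suc m). par w = a}"
    then have "E a w" using E_par[of w] S_D(1,3)[of w] by blast
    moreover have "dep w \<noteq> dep (par a)" using w dep_par[OF a(1,3)] a(2) by (simp add: S_iff)
    ultimately show "w \<in> {w. E a w} - {par a}" by blast
  next
    fix w assume "w \<in> {w. E a w} - {par a}"
    then have w: "E a w" "w \<noteq> par a" by auto
    then have "dep w = Suc (dep a)" using dep_neighbour a by blast
    then show "w \<in> {w \<in> S (Suc m). par w = a}"
      using par_unique[OF w(1)] a E_right[OF w(1)] by (simp add: S_iff)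
  qed
  moreover have "par a \<in> {w. E a w}" using E_sym[OF E_par[OF a(1,3)]] by simp
  moreover have "card {w. E a w} = q + 1" using hom a(1) by (simp add: homogeneous_tree_def)
  ultimately show ?thesis by simp
qed

lemma finite_S: "finite (S n)"
proof (induction n)
  case 0
  have "S 0 \<subseteq> {origin}" using dep_eq_0 S_D by blast
  then show ?case using finite_subset by blast
next
  case (Suc n)
  have "S (Suc n) \<subseteq> (\<Union>a\<in>S n. {w. E a w})"
  proof
    fix w assume w: "w \<in> S (Suc n)"
    then have "E (par w) w" using E_par S_D by blast
    then show "w \<in> (\<Union>a\<in>S n. {w. E a w})" using par_S[OF w] by blast
  qed
  moreover have "finite {w. E a w}" if "a \<in> S n" for a
  proof -
    have "card {w. E a w} = q + 1" using hom S_D(1)[OF that] by (simp add: homogeneous_tree_def)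
    then show ?thesis by (intro card_ge_0_finite) simp
  qed
  ultimately show ?case using Suc by (blast intro: finite_subset)
qed

text \<open>The walk climbs from \<open>x\<close> to the common ancestor and descends to
  \<open>y\<close>; the assumption \<open>ne\<close> says that it does not backtrack at the
  top.\<close>

lemma graph_dist_branching:
  assumes x: "x \<in> S n" and y: "y \<in> S n" and h: "h \<ge> 1" "h \<le> n"
    and top: "anc h x = anc h y" and ne: "anc (h - 1) x \<noteq> anc (h - 1) y"
  shows "graph_dist V E x y = 2 * h"
proof -
  define g where "g i = (if i \<le> h then anc i x else anc (2 * h - i) y)" for i
  have up: "E (anc i z) (anc (Suc i) z)" if "z \<in> S n" "i < h" for i z
  proof -
    have "anc i z \<in> S (Suc (n - Suc i))" using anc_S[of z n i] that h by (simp add: Suc_diff_Suc)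
    then show ?thesis using E_sym[OF E_par[OF S_D(1,3)]] by simp
  qed
  have nn: "anc i z \<noteq> anc (Suc (Suc i)) z" if "z \<in> S n" "Suc (Suc i) \<le> h" for i z
  proof -
    have "dep (anc i z) = n - i" by (intro S_D(2) anc_S) (use that h in auto)
    moreover have "dep (anc (Suc (Suc i)) z) = n - Suc (Suc i)"
      by (intro S_D(2) anc_S) (use that h in auto)
    moreover have "n - i \<noteq> n - Suc (Suc i)" using that(2) h(2) by linarith
    ultimately show ?thesis by metis
  qed
  have "E (g i) (g (Suc i))" if "i < 2 * h" for i
  proof (cases "i < h")
    case True
    then show ?thesis using up[OF x, of i] by (simp add: g_def)
  next
    case False
    then have "E (anc (2 * h - Suc i) y) (anc (Suc (2 * h - Suc i)) y)"
      using up[OF y, of "2 * h - Suc i"] that by simp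
    moreover have "Suc (2 * h - Suc i) = 2 * h - i" using that by simp
    moreover have "g i = anc (2 * h - i) y" using False top by (cases "i = h") (auto simp: g_def)
    ultimately show ?thesis using False E_sym[of "g (Suc i)" "g i"] by (simp add: g_def)
  qed
  moreover have "g i \<noteq> g (Suc (Suc i))" if "Suc (Suc i) \<le> 2 * h" for i
  proof -
    consider "Suc (Suc i) \<le> h" | "Suc i = h" | "i \<ge> h" by linarith
    then show ?thesis
    proof cases
      case 1
      then show ?thesis using nn[OF x, of i] by (simp add: g_def)
    next
      case 2
      then have "i = h - 1" "2 * h - Suc (Suc i) = h - 1" by auto
      then show ?thesis using ne 2 by (simp add: g_def)
    next
      case 3
      then have "g i = anc (2 * h - i) y" using top by (cases "i = h") (auto simp: g_def)
      moreover have "2 * h - i = Suc (Suc (2 * h - Suc (Suc i)))" using that by simp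
      moreover have "Suc (Suc (2 * h - Suc (Suc i))) \<le> h" using 3 that by linarith
      then have "anc (2 * h - Suc (Suc i)) y \<noteq> anc (Suc (Suc (2 * h - Suc (Suc i)))) y"
        by (rule nn[OF y])
      moreover have "g (Suc (Suc i)) = anc (2 * h - Suc (Suc i)) y" using 3 by (simp add: g_def)
      ultimately show ?thesis by metis
    qed
  qed
  ultimately have "nb_walk E g (2 * h)" by (simp add: nb_walk_def)
  moreover have "g 0 = x" "g (2 * h) = y" using h by (auto simp: g_def)
  ultimately show ?thesis
    using graph_dist_nb_walk[OF tree, of g "2 * h"] x y by (simp add: S_iff)
qed

section \<open>Counting descendants and the descending paths that meet a given set\<close>

text \<open>One level of descent: the children outside \<open>C\<close> are counted parent by
  parent, with at least \<open>l\<close> of them under each vertex of \<open>A\<close>.\<close>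

lemma card_extend:
  assumes A: "A \<subseteq> S m" and l: "\<And>a. a \<in> A \<Longrightarrow> l \<le> card ({w \<in> S (Suc m). par w = a} - C)"
  shows "l * card A \<le> card {w \<in> S (Suc m). par w \<in> A \<and> w \<notin> C}"
proof -
  have fA: "finite A" using A finite_S finite_subset by blast
  have "{w \<in> S (Suc m). par w \<in> A \<and> w \<notin> C} = (\<Union>a\<in>A. {w \<in> S (Suc m). par w = a} - C)" by auto
  also have "card \<dots> = (\<Sum>a\<in>A. card ({w \<in> S (Suc m). par w = a} - C))"
    by (rule card_UN_disjoint) (use fA finite_S in auto)
  also have "\<dots> \<ge> (\<Sum>a\<in>A. l)" by (rule sum_mono) (rule l)
  finally show ?thesis by (simp add: mult.commute)
qed

lemma card_descendants:
  assumes A: "A \<subseteq> S m" and m: "m \<ge> 1"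
  shows "card {x \<in> S (m + L). anc L x \<in> A} = q ^ L * card A"
proof (induction L)
  case 0
  have "{x \<in> S m. x \<in> A} = A" using A by auto
  then show ?case by simp
next
  case (Suc L)
  let ?D = "{x \<in> S (m + L). anc L x \<in> A}"
  have eq: "{x \<in> S (m + Suc L). anc (Suc L) x \<in> A} = (\<Union>a\<in>?D. {w \<in> S (Suc (m + L)). par w = a})"
    using par_S[of _ "m + L"] by (auto simp del: funpow.simps simp: funpow_Suc_right)
  have "card {x \<in> S (m + Suc L). anc (Suc L) x \<in> A} = (\<Sum>a\<in>?D. card {w \<in> S (Suc (m + L)). par w = a})"
    unfolding eq by (rule card_UN_disjoint) (use finite_S in auto)
  also have "\<dots> = (\<Sum>a\<in>?D. q)"
  proof (rule sum.cong[OF refl])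
    fix a assume "a \<in> ?D"
    then have "a \<in> S (m + L)" by blast
    then show "card {w \<in> S (Suc (m + L)). par w = a} = q" by (rule card_children) (use m in linarith)
  qed
  also have "\<dots> = card ?D * q" by simp
  finally show ?case unfolding Suc by (simp only: power_Suc mult_ac)
qed

lemma card_S:
  assumes "b < n" shows "card (S n) = q ^ b * card (S (n - b))"
proof -
  have "{x \<in> S n. anc b x \<in> S (n - b)} = S n" using anc_S[of _ n b] assms by auto
  then show ?thesis using card_descendants[of "S (n - b)" "n - b" b] assms by simp
qed

text \<open>Since \<open>C\<close> contains at most one of any set of siblings, a descent through a
  depth that \<open>C\<close> meets loses at most one of the \<open>q\<close> children of each
  vertex, a fraction \<open>1 / q\<close>. Depths that \<open>C\<close> does not meet lose nothing,
  so the exponent counts only the former.\<close>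

lemma card_avoiding:
  assumes A: "A \<subseteq> S m" and m: "m \<ge> 1"
    and C: "\<And>c c'. c \<in> C \<Longrightarrow> c' \<in> C \<Longrightarrow> par c = par c' \<Longrightarrow> c = c'"
  shows "(1 - 1 / real q) ^ card {d \<in> {m<..m + L}. C \<inter> S d \<noteq> {}} * (q ^ L * card A)
    \<le> card {x \<in> S (m + L). anc L x \<in> A \<and> (\<forall>l<L. anc l x \<notin> C)}"
proof (induction L)
  case 0
  have "{x \<in> S m. x \<in> A} = A" using A by auto
  then show ?case by simp
next
  case (Suc L)
  let ?D = "{x \<in> S (m + L). anc L x \<in> A \<and> (\<forall>l<L. anc l x \<notin> C)}"
  let ?K = "\<lambda>L. {d \<in> {m<..m + L}. C \<inter> S d \<noteq> {}}"
  define p where "p = 1 - 1 / real q"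
  \<comment> \<open>The descent is extended at the bottom: \<open>w\<close> is the new vertex, and
    the ancestor of \<open>w\<close> of index \<open>l + 1\<close> is that of \<open>par w\<close>
    of index \<open>l\<close>.\<close>
  have eq: "{x \<in> S (m + Suc L). anc (Suc L) x \<in> A \<and> (\<forall>l<Suc L. anc l x \<notin> C)}
      = {w \<in> S (Suc (m + L)). par w \<in> ?D \<and> w \<notin> C}"
    using par_S[of _ "m + L"] by (auto simp del: funpow.simps(2) simp: funpow_Suc_right All_less_Suc2)
  have D: "?D \<subseteq> S (m + L)" by auto
  show ?case
  proof (cases "C \<inter> S (m + Suc L) = {}")
    case True
    have "q \<le> card ({w \<in> S (Suc (m + L)). par w = a} - C)" if "a \<in> ?D" for a
    proof -
      have "{w \<in> S (Suc (m + L)). par w = a} - C = {w \<in> S (Suc (m + L)). par w = a}"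
        using True by auto
      then show ?thesis using card_children[of a "m + L"] that m by simp
    qed
    from card_extend[OF D this] have "q * card ?D \<le> card {w \<in> S (Suc (m + L)). par w \<in> ?D \<and> w \<notin> C}" .
    then have "real q * card ?D \<le> card {w \<in> S (Suc (m + L)). par w \<in> ?D \<and> w \<notin> C}"
      by (simp only: flip: of_nat_mult of_nat_le_iff)
    moreover have "?K (Suc L) = ?K L" using True by (auto simp: le_Suc_eq)
    moreover have "real q * (p ^ card (?K L) * (q ^ L * card A)) \<le> real q * card ?D"
      by (rule mult_left_mono[OF Suc[folded p_def]]) simp
    ultimately show ?thesis unfolding eq p_def[symmetric] by (simp add: mult_ac)
  next
    case False
    have "q - 1 \<le> card ({w \<in> S (Suc (m + L)). par w = a} - C)" if "a \<in> ?D" for a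
    proof -
      let ?W = "{w \<in> S (Suc (m + L)). par w = a}"
      have "?W \<inter> C = {} \<or> (\<exists>c. ?W \<inter> C = {c})" using C by blast
      then have "card (?W \<inter> C) \<le> 1" by auto
      moreover have "card (?W - C) = card ?W - card (?W \<inter> C)"
        by (rule card_Diff_subset_Int) (use finite_S in auto)
      ultimately show ?thesis using card_children[of a "m + L"] that m by simp
    qed
    from card_extend[OF D this]
    have "(q - 1) * card ?D \<le> card {w \<in> S (Suc (m + L)). par w \<in> ?D \<and> w \<notin> C}" .
    then have "real (q - 1) * card ?D \<le> card {w \<in> S (Suc (m + L)). par w \<in> ?D \<and> w \<notin> C}"
      by (simp only: flip: of_nat_mult of_nat_le_iff)
    moreover have "real (q - 1) = p * q" using q by (simp add: p_def field_simps of_nat_diff)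
    moreover have "card (?K (Suc L)) = Suc (card (?K L))"
    proof -
      have "?K (Suc L) = insert (m + Suc L) (?K L)" using False by (auto simp: le_Suc_eq)
      moreover have "m + Suc L \<notin> ?K L" by simp
      moreover have "finite (?K L)" by (rule finite_subset[of _ "{m<..m + L}"]) auto
      ultimately show ?thesis by simp
    qed
    moreover have "p * q * (p ^ card (?K L) * (q ^ L * card A)) \<le> p * q * card ?D"
      by (rule mult_left_mono[OF Suc[folded p_def]]) (use q in \<open>simp add: p_def\<close>)
    ultimately show ?thesis unfolding eq p_def[symmetric] by (simp add: mult_ac)
  qed
qed

text \<open>The complement of \<open>card_avoiding\<close> among the descendants of
  \<open>A\<close>; as \<open>1 - 1 / q\<close> is at most 1, the number of depths may be replaced
  by the bound \<open>k\<close>.\<close>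

lemma card_hitting:
  assumes A: "A \<subseteq> S m" and m: "m \<ge> 1"
    and C: "\<And>c c'. c \<in> C \<Longrightarrow> c' \<in> C \<Longrightarrow> par c = par c' \<Longrightarrow> c = c'"
    and k: "card {d \<in> {m<..m + L}. C \<inter> S d \<noteq> {}} \<le> k"
  shows "card {x \<in> S (m + L). anc L x \<in> A \<and> (\<exists>l<L. anc l x \<in> C)}
    \<le> (1 - (1 - 1 / real q) ^ k) * card {x \<in> S (m + L). anc L x \<in> A}"
proof -
  let ?D = "{x \<in> S (m + L). anc L x \<in> A}"
  let ?N = "{x \<in> S (m + L). anc L x \<in> A \<and> (\<forall>l<L. anc l x \<notin> C)}"
  let ?H = "{x \<in> S (m + L). anc L x \<in> A \<and> (\<exists>l<L. anc l x \<in> C)}"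
  have "?D = ?N \<union> ?H" by auto
  moreover have "card (?N \<union> ?H) = card ?N + card ?H"
    by (rule card_Un_disjoint) (use finite_S in auto)
  ultimately have "real (card ?D) = card ?N + card ?H" by simp
  moreover have "(1 - 1 / real q) ^ k * card ?D \<le> card ?N"
  proof -
    have "(1 - 1 / real q) ^ k \<le> (1 - 1 / real q) ^ card {d \<in> {m<..m + L}. C \<inter> S d \<noteq> {}}"
      by (rule power_decreasing[OF k]) (use q in auto)
    then have "(1 - 1 / real q) ^ k * card ?D
        \<le> (1 - 1 / real q) ^ card {d \<in> {m<..m + L}. C \<inter> S d \<noteq> {}} * card ?D"
      by (rule mult_right_mono) simp
    also have "\<dots> \<le> card ?N"
      unfolding card_descendants[OF A m] by (rule card_avoiding[OF A m C])
    finally show ?thesis .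
  qed
  ultimately show ?thesis by (simp add: algebra_simps)
qed

text \<open>Independence of blocks: the induction peels off the lowest one, at heights up to
  \<open>b 1\<close>. The conditions of the other blocks depend only on the ancestor at height
  \<open>b 1\<close>, so they define a set \<open>A\<close> of such ancestors, and
  \<open>card_hitting\<close> below \<open>A\<close> contributes one factor.\<close>

lemma card_hitting_blocks:
  assumes C: "\<And>c c'. c \<in> C \<Longrightarrow> c' \<in> C \<Longrightarrow> par c = par c' \<Longrightarrow> c = c'"
    and "\<And>i. b i \<le> b (Suc i)" and "b J < n"
    and "\<And>i. i < J \<Longrightarrow> card {d \<in> {n - b (Suc i)<..n - b i}. C \<inter> S d \<noteq> {}} \<le> k"
  shows "card {x \<in> S n. \<forall>i<J. \<exists>s\<in>{b i<..b (Suc i)}. anc (s - 1) x \<in> C}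
    \<le> (1 - (1 - 1 / real q) ^ k) ^ J * card (S n)"
  using assms(2-4)
proof (induction J arbitrary: b)
  case 0
  then show ?case by simp
next
  case (Suc J)
  let ?\<rho> = "1 - (1 - 1 / real q) ^ k"
  have mono: "b 1 \<le> b (Suc i)" for i
    using lift_Suc_mono_le[of b 1 "Suc i"] Suc.prems(1) by simp
  have b1: "b 1 < n" using mono[of J] Suc.prems(2) by simp
  let ?Z = "{x \<in> S n. \<forall>i<J. \<exists>s\<in>{b (Suc i)<..b (Suc (Suc i))}. anc (s - 1) x \<in> C}"
  have Z: "card ?Z \<le> ?\<rho> ^ J * card (S n)"
    using Suc.IH[of "\<lambda>i. b (Suc i)"] Suc.prems by simp
  let ?m = "n - b 1"
  \<comment> \<open>The conditions of the higher blocks, read from the ancestor at height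
    \<open>b 1\<close>. No truncation occurs in \<open>s - 1 - b 1\<close>, because \<open>s\<close>
    exceeds \<open>b 1\<close>.\<close>
  define A where "A = {a \<in> S ?m. \<forall>i<J. \<exists>s\<in>{b (Suc i)<..b (Suc (Suc i))}. anc (s - 1 - b 1) a \<in> C}"
  have ancs: "anc (s - 1 - b 1) (anc (b 1) x) = anc (s - 1) x" if "s > b (Suc i)" for s i x
  proof -
    have "s - 1 = (s - 1 - b 1) + b 1" using that mono[of i] by simp
    then show ?thesis by (metis funpow_add comp_apply)
  qed
  have "anc (b 1) x \<in> A \<longleftrightarrow> x \<in> ?Z" if "x \<in> S n" for x
  proof -
    have "(\<exists>s\<in>{b (Suc i)<..b (Suc (Suc i))}. anc (s - 1 - b 1) (anc (b 1) x) \<in> C) \<longleftrightarrow>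
        (\<exists>s\<in>{b (Suc i)<..b (Suc (Suc i))}. anc (s - 1) x \<in> C)" for i
      by (rule bex_cong[OF refl]) (simp only: greaterThanAtMost_iff ancs[of i])
    moreover have "anc (b 1) x \<in> S ?m" using that anc_S[of x n "b 1"] b1 by simp
    ultimately show ?thesis using that unfolding A_def by simp
  qed
  then have ZA: "?Z = {x \<in> S (?m + b 1). anc (b 1) x \<in> A}" using b1 by auto
  \<comment> \<open>The descent from \<open>A\<close> passes through all heights below
    \<open>b 1\<close>, including those below the block; \<open>C'\<close> keeps only the depths
    that belong to the block, so that at most \<open>k\<close> of them are met.\<close>
  define C' where "C' = {c \<in> C. dep c \<in> {?m<..n - b 0}}"
  have "{x \<in> S n. \<forall>i<Suc J. \<exists>s\<in>{b i<..b (Suc i)}. anc (s - 1) x \<in> C}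
    \<subseteq> {x \<in> S (?m + b 1). anc (b 1) x \<in> A \<and> (\<exists>l<b 1. anc l x \<in> C')}"
  proof
    fix x assume x: "x \<in> {x \<in> S n. \<forall>i<Suc J. \<exists>s\<in>{b i<..b (Suc i)}. anc (s - 1) x \<in> C}"
    then have "x \<in> ?Z" by auto
    moreover obtain s where s: "s \<in> {b 0<..b 1}" "anc (s - 1) x \<in> C" using x by auto
    have "dep (anc (s - 1) x) = n - (s - 1)" using anc_S[of x n "s - 1"] x s b1 by (auto simp: S_iff)
    then have "anc (s - 1) x \<in> C'" using s b1 by (auto simp: C'_def)
    moreover have "s - 1 < b 1" using s(1) by auto
    ultimately show "x \<in> {x \<in> S (?m + b 1). anc (b 1) x \<in> A \<and> (\<exists>l<b 1. anc l x \<in> C')}"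
      using ZA by blast
  qed
  then have "card {x \<in> S n. \<forall>i<Suc J. \<exists>s\<in>{b i<..b (Suc i)}. anc (s - 1) x \<in> C}
    \<le> card {x \<in> S (?m + b 1). anc (b 1) x \<in> A \<and> (\<exists>l<b 1. anc l x \<in> C')}"
    by (rule card_mono[rotated]) (use finite_S in auto)
  also have "\<dots> \<le> ?\<rho> * card ?Z"
    unfolding ZA
  proof (rule card_hitting)
    show "A \<subseteq> S ?m" by (auto simp: A_def)
    show "1 \<le> ?m" using b1 by simp
    have "{d \<in> {?m<..?m + b 1}. C' \<inter> S d \<noteq> {}} \<subseteq> {d \<in> {n - b (Suc 0)<..n - b 0}. C \<inter> S d \<noteq> {}}"
      by (auto simp: C'_def S_iff)
    then have "card {d \<in> {?m<..?m + b 1}. C' \<inter> S d \<noteq> {}}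
        \<le> card {d \<in> {n - b (Suc 0)<..n - b 0}. C \<inter> S d \<noteq> {}}"
      by (rule card_mono[rotated]) (rule finite_subset[of _ "{..n}"], auto)
    then show "card {d \<in> {?m<..?m + b 1}. C' \<inter> S d \<noteq> {}} \<le> k"
      using Suc.prems(3)[of 0] by simp
  qed (use C in \<open>auto simp: C'_def\<close>)
  also have "\<dots> \<le> ?\<rho> * (?\<rho> ^ J * card (S n))"
    by (rule mult_left_mono[OF Z]) (use q in \<open>auto intro!: power_le_one\<close>)
  finally show ?case by simp
qed

section \<open>Thin branches and the resulting density bound\<close>

text \<open>
  Heights \<open>s\<close> are measured from the sphere \<open>S n\<close> towards the root, so \<open>anc s x\<close> has depth \<open>n - s\<close>.
\<close>

definition branch where
  "branch X n s x = {y \<in> X \<inter> S n. anc s y = anc s x \<and> anc (s - 1) y \<noteq> anc (s - 1) x}"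

definition cone where
  "cone X n s a = {y \<in> X \<inter> S n. anc s y = a}"

lemma finite_branch: "finite (branch X n s x)" and finite_cone: "finite (cone X n s a)"
  using finite_S by (auto simp: branch_def cone_def)

text \<open>Each ancestor at height \<open>s\<close> accounts for fewer than \<open>M\<close>
  points, and there are only \<open>card (S n) / q ^ s\<close> such ancestors. Replacing
  \<open>1 / q\<close> by \<open>1 / 2\<close> leaves a series with sum independent of
  \<open>q\<close>.\<close>

lemma card_light:
  fixes M :: nat
  assumes "s < n"
  shows "card {x \<in> X \<inter> S n. card (cone X n s (anc s x)) < M} \<le> M * (1/2) ^ s * card (S n)"
proof -
  let ?A = "{a \<in> S (n - s). card (cone X n s a) < M}"
  have "{x \<in> X \<inter> S n. card (cone X n s (anc s x)) < M} \<subseteq> (\<Union>a\<in>?A. cone X n s a)"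
    using anc_S[of _ n s] assms by (auto simp: cone_def)
  then have "card {x \<in> X \<inter> S n. card (cone X n s (anc s x)) < M} \<le> card (\<Union>a\<in>?A. cone X n s a)"
    by (rule card_mono[rotated]) (use finite_S finite_cone in auto)
  also have "\<dots> \<le> (\<Sum>a\<in>?A. card (cone X n s a))" by (rule card_UN_le) (use finite_S in auto)
  also have "\<dots> \<le> (\<Sum>a\<in>?A. M)" by (rule sum_mono) auto
  also have "\<dots> \<le> M * card (S (n - s))" using finite_S by (auto intro!: card_mono)
  finally have "real (card {x \<in> X \<inter> S n. card (cone X n s (anc s x)) < M}) \<le> real M * real (card (S (n - s)))"
    by (simp only: flip: of_nat_mult of_nat_le_iff)
  also have "\<dots> \<le> real M * ((1/2) ^ s * card (S n))"
  proof -
    have "(2::real) ^ s \<le> real q ^ s" by (rule power_mono) (use q in auto)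
    then have "2 ^ s * real (card (S (n - s))) \<le> card (S n)"
      unfolding card_S[OF assms] by (simp add: mult_right_mono)
    then have "real (card (S (n - s))) \<le> (1/2) ^ s * card (S n)" by (simp add: field_simps)
    then show ?thesis by (rule mult_left_mono) simp
  qed
  finally show ?thesis by (simp add: mult.assoc)
qed

text \<open>If the two children differed, every point of the cone would avoid at least one of them.
  The two branches would then cover the cone, which has too many points for that.\<close>

lemma thin_branch_child_unique:
  assumes "x \<in> X \<inter> S n" "x' \<in> X \<inter> S n" and "anc s x = anc s x'"
    and "card (branch X n s x) < R" "card (branch X n s x') < R"
    and heavy: "2 * R \<le> card (cone X n s (anc s x))"
  shows "anc (s - 1) x = anc (s - 1) x'"
proof (rule ccontr)
  assume "anc (s - 1) x \<noteq> anc (s - 1) x'"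
  then have "cone X n s (anc s x) \<subseteq> branch X n s x \<union> branch X n s x'"
    using assms(3) by (auto simp: cone_def branch_def)
  then have "card (cone X n s (anc s x)) \<le> card (branch X n s x \<union> branch X n s x')"
    by (rule card_mono[rotated]) (simp add: finite_branch)
  also have "\<dots> \<le> card (branch X n s x) + card (branch X n s x')" by (rule card_Un_le)
  finally show False using assms by simp
qed

lemma sum_half_powers: "a \<le> c \<Longrightarrow> (\<Sum>s\<in>{a<..c::nat}. (1/2::real) ^ s) \<le> (1/2) ^ a"
proof -
  assume "a \<le> c"
  then have "(\<Sum>s\<in>{a<..c}. (1/2::real) ^ s) = (1/2) ^ a - (1/2) ^ c"
  proof (induction rule: dec_induct)
    case (step c)
    have "{a<..Suc c} = insert (Suc c) {a<..c}" using step by auto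
    then show ?case using step by simp
  qed simp
  then show ?thesis by simp
qed

text \<open>A point of \<open>X\<close> in the sphere either has a light cone at some height above
  \<open>b 0\<close>, which is rare by a geometric series, or follows a distinguished child in each
  of the \<open>J\<close> blocks, which is rare by \<open>card_hitting_blocks\<close>.\<close>

lemma card_thin_le:
  fixes R :: nat
  assumes b: "\<And>i. b i \<le> b (Suc i)" and n: "b J < n"
    and T: "\<And>i. T i \<subseteq> {b i<..b (Suc i)}" "\<And>i. card (T i) \<le> k"
    and thin: "\<And>x i. x \<in> X \<inter> S n \<Longrightarrow> i < J \<Longrightarrow> \<exists>s\<in>T i. card (branch X n s x) < R"
  shows "card (X \<inter> S n) \<le> ((1 - (1 - 1 / real q) ^ k) ^ J + 2 * R * (1/2) ^ b 0) * card (S n)"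
proof -
  have mono: "i \<le> j \<Longrightarrow> b i \<le> b j" for i j using lift_Suc_mono_le[of b] b by blast
  have finT: "finite (T i)" for i using T(1) finite_subset by blast
  let ?U = "\<Union>i<J. T i"
  have U: "s \<in> {b 0<..b J}" if s: "s \<in> ?U" for s
  proof -
    obtain i where "i < J" "s \<in> T i" using s by blast
    then show ?thesis using T(1)[of i] mono[of 0 i] mono[of "Suc i" J] by auto
  qed
  have block: "s \<in> T i" if s: "s \<in> ?U" "s \<in> {b i<..b (Suc i)}" for s i
  proof -
    obtain j where j: "j < J" "s \<in> T j" using s(1) by blast
    then have "s \<in> {b j<..b (Suc j)}" using T(1) by blast
    then have "i = j" using s(2) mono[of "Suc i" j] mono[of "Suc j" i]
      by (metis Suc_leI greaterThanAtMost_iff le_trans linorder_neqE_nat not_le)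
    then show ?thesis using j by simp
  qed
  \<comment> \<open>The distinguished children: those through which a point with a thin branch and a
    heavy cone descends from its ancestor at height \<open>s\<close>.\<close>
  define C where "C = {anc (s - 1) x |s x. s \<in> ?U \<and> x \<in> X \<inter> S n \<and> card (branch X n s x) < R \<and>
    2 * R \<le> card (cone X n s (anc s x))}"
  have depC: "dep (anc (s - 1) x) = Suc (n - s)" if "s \<in> ?U" "x \<in> X \<inter> S n" for s x
  proof -
    have "0 < s" "s < n" using U[OF that(1)] n by auto
    then show ?thesis using anc_S[of x n "s - 1"] that(2) by (auto simp: S_iff)
  qed
  have "c = c'" if cc': "c \<in> C" "c' \<in> C" "par c = par c'" for c c'
  proof -
    obtain s x where c: "c = anc (s - 1) x" "s \<in> ?U" "x \<in> X \<inter> S n" "card (branch X n s x) < R"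
      "2 * R \<le> card (cone X n s (anc s x))" using cc'(1) unfolding C_def by blast
    obtain s' x' where c': "c' = anc (s' - 1) x'" "s' \<in> ?U" "x' \<in> X \<inter> S n"
      "card (branch X n s' x') < R"
      using cc'(2) unfolding C_def by blast
    have pos: "0 < s" "s < n" "0 < s'" "s' < n" using U[OF c(2)] U[OF c'(2)] n by auto
    have par: "par c = anc s x" "par c' = anc s' x'"
      using pos by (cases s; cases s'; simp add: c(1) c'(1))+
    \<comment> \<open>Equal parents have equal depth, so both children arise at the same height and
      \<open>thin_branch_child_unique\<close> applies.\<close>
    have "n - s = n - s'"
      using anc_S[of x n s] anc_S[of x' n s'] c(3) c'(3) pos par cc'(3) by (simp add: S_iff)
    then have "s = s'" using pos by simp
    then show ?thesis using thin_branch_child_unique[of x X n x' s R] c c' par cc'(3) by simp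
  qed
  moreover have "card {d \<in> {n - b (Suc i)<..n - b i}. C \<inter> S d \<noteq> {}} \<le> k" if "i < J" for i
  proof -
    \<comment> \<open>A distinguished child for height \<open>s\<close> has depth
      \<open>n - s + 1\<close>, so the depth determines the height. As blocks are disjoint, this
      height lies in \<open>T i\<close>.\<close>
    have "{d \<in> {n - b (Suc i)<..n - b i}. C \<inter> S d \<noteq> {}} \<subseteq> (\<lambda>s. Suc (n - s)) ` T i"
    proof
      fix d assume "d \<in> {d \<in> {n - b (Suc i)<..n - b i}. C \<inter> S d \<noteq> {}}"
      then obtain s x where d: "d \<in> {n - b (Suc i)<..n - b i}" "s \<in> ?U" "x \<in> X \<inter> S n"
        "anc (s - 1) x \<in> S d" unfolding C_def by blast
      then have "d = Suc (n - s)" using depC[OF d(2,3)] by (simp add: S_iff)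
      moreover have "s < n" using U[OF d(2)] n by auto
      ultimately have "s \<in> {b i<..b (Suc i)}" using d(1) by auto
      then show "d \<in> (\<lambda>s. Suc (n - s)) ` T i" using block d(2) \<open>d = _\<close> by blast
    qed
    then have "card {d \<in> {n - b (Suc i)<..n - b i}. C \<inter> S d \<noteq> {}} \<le> card ((\<lambda>s. Suc (n - s)) ` T i)"
      by (rule card_mono[rotated]) (simp add: finT)
    also have "\<dots> \<le> card (T i)" by (rule card_image_le[OF finT])
    finally show ?thesis using T(2)[of i] by simp
  qed
  ultimately have H: "card {x \<in> S n. \<forall>i<J. \<exists>s\<in>{b i<..b (Suc i)}. anc (s - 1) x \<in> C}
      \<le> (1 - (1 - 1 / real q) ^ k) ^ J * card (S n)" (is "real (card ?H) \<le> _")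
    using card_hitting_blocks[of C b J n k] b n by blast
  let ?L = "\<lambda>s. {x \<in> X \<inter> S n. card (cone X n s (anc s x)) < 2 * R}"
  have "X \<inter> S n \<subseteq> ?H \<union> (\<Union>s\<in>{b 0<..b J}. ?L s)"
  proof
    fix x assume x: "x \<in> X \<inter> S n"
    show "x \<in> ?H \<union> (\<Union>s\<in>{b 0<..b J}. ?L s)"
    proof (cases "\<exists>s\<in>{b 0<..b J}. x \<in> ?L s")
      case False
      have "\<exists>s\<in>{b i<..b (Suc i)}. anc (s - 1) x \<in> C" if i: "i < J" for i
      proof -
        obtain s where s: "s \<in> T i" "card (branch X n s x) < R" using thin[OF x i] by blast
        then have sU: "s \<in> ?U" using i by blast
        then have "2 * R \<le> card (cone X n s (anc s x))" using False U[OF sU] x by force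
        then have "anc (s - 1) x \<in> C" using s sU x unfolding C_def by blast
        then show ?thesis using s(1) T(1) by blast
      qed
      then show ?thesis using x by blast
    qed blast
  qed
  then have "card (X \<inter> S n) \<le> card (?H \<union> (\<Union>s\<in>{b 0<..b J}. ?L s))"
    by (rule card_mono[rotated]) (use finite_S in auto)
  also have "\<dots> \<le> card ?H + card (\<Union>s\<in>{b 0<..b J}. ?L s)" by (rule card_Un_le)
  also have "\<dots> \<le> card ?H + (\<Sum>s\<in>{b 0<..b J}. card (?L s))"
    by (rule add_left_mono, rule card_UN_le) simp
  finally have "real (card (X \<inter> S n)) \<le> card ?H + (\<Sum>s\<in>{b 0<..b J}. real (card (?L s)))"
    by (simp only: flip: of_nat_add of_nat_sum of_nat_le_iff)
  also have "(\<Sum>s\<in>{b 0<..b J}. real (card (?L s)))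
      \<le> (\<Sum>s\<in>{b 0<..b J}. real (2 * R) * (1/2) ^ s * card (S n))"
    by (rule sum_mono, rule card_light) (use n in auto)
  also have "\<dots> = 2 * R * card (S n) * (\<Sum>s\<in>{b 0<..b J}. (1/2) ^ s)"
    by (simp add: sum_distrib_left mult_ac)
  also have "\<dots> \<le> 2 * R * card (S n) * (1/2) ^ b 0"
    by (rule mult_left_mono[OF sum_half_powers[OF mono]]) auto
  finally show ?thesis using H by (simp add: algebra_simps)
qed

section \<open>Stars from large branches\<close>

text \<open>The centre is \<open>x\<close>, and the leaves at distance \<open>2 * t ! i\<close> are
  chosen in the branch at height \<open>t ! i\<close>. Strict monotonicity of \<open>t\<close> keeps
  the distance classes apart, and the star is balanced because it lies in one sphere.\<close>

lemma star_from_branches: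
  assumes x: "x \<in> X \<inter> S n" and t: "t \<in> incr_seqs k" and tn: "\<And>i. i < k \<Longrightarrow> t ! i \<le> n"
    and r: "\<And>i. i < k \<Longrightarrow> r ! i \<le> card (branch X n (t ! i) x)"
  shows "\<exists>Y v0. Y \<subseteq> X \<and> is_star V E k t r Y v0 \<and> balanced V E origin Y"
proof -
  have "\<forall>i. \<exists>B. i < k \<longrightarrow> B \<subseteq> branch X n (t ! i) x \<and> card B = r ! i"
    using r by (metis obtain_subset_with_card_n)
  then obtain B where B: "\<And>i. i < k \<Longrightarrow> B i \<subseteq> branch X n (t ! i) x \<and> card (B i) = r ! i"
    by metis
  define Y where "Y = insert x (\<Union>i<k. B i)"
  have pos: "t ! i > 0" if "i < k" for i using t that by (auto simp: incr_seqs_def)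
  have inj: "i = j" if "i < k" "j < k" "t ! i = t ! j" for i j
    using t that unfolding incr_seqs_def sorted_wrt_iff_nth_less
    by (metis (mono_tags, lifting) linorder_neqE_nat mem_Collect_eq nat_less_le)
  have YS: "Y \<subseteq> X \<inter> S n" using B x by (auto simp: Y_def branch_def)
  have dist: "graph_dist V E x y = 2 * t ! i" if "i < k" "y \<in> B i" for i y
  proof (rule graph_dist_branching[where n = n])
    have "y \<in> branch X n (t ! i) x" using B that by blast
    then show "y \<in> S n" "anc (t ! i) x = anc (t ! i) y" "anc (t ! i - 1) x \<noteq> anc (t ! i - 1) y"
      by (auto simp: branch_def)
  qed (use x pos[OF that(1)] tn[OF that(1)] in auto)
  have dist0: "graph_dist V E x x = 0"
    using graph_dist_nb_walk[OF tree, of "\<lambda>_. x" 0] x by (simp add: nb_walk_def S_iff)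
  have "{v \<in> Y. graph_dist V E x v = 2 * t ! i} = B i" if "i < k" for i
  proof (intro equalityI subsetI)
    fix v assume v: "v \<in> {v \<in> Y. graph_dist V E x v = 2 * t ! i}"
    then have "v \<noteq> x" using dist0 pos[OF that] by auto
    then obtain j where j: "j < k" "v \<in> B j" using v by (auto simp: Y_def)
    then have "t ! j = t ! i" using dist[OF j] v by simp
    then show "v \<in> B i" using inj[of j i] j that by simp
  qed (use that dist in \<open>auto simp: Y_def\<close>)
  moreover have "finite (B i)" if "i < k" for i using B[OF that] finite_branch finite_subset by blast
  moreover have "\<forall>v\<in>Y - {x}. graph_dist V E x v \<in> {2 * t ! i |i. i < k}"
    using dist by (auto simp: Y_def)
  ultimately have "is_star V E k t r Y x"
    unfolding is_star_def using B YS by (auto simp: Y_def S_iff)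
  moreover have "balanced V E origin Y"
    unfolding balanced_def using YS S_D(2) by blast
  ultimately show ?thesis using YS by blast
qed

end

section \<open>Choice of blocks and constants for the contradiction\<close>

theorem theorem1p3:
  fixes q k :: nat
    and V X :: "'a set"
    and E :: "'a \<Rightarrow> 'a \<Rightarrow> bool"
    and origin :: 'a
    and r :: "nat list"
  assumes "homogeneous_tree q V E"
    and "q + 1 \<ge> 3"
    and "origin \<in> V"
    and "X \<subseteq> V"
    and "upper_density V E origin X > 0"
    and "k > 0"
    and "length r = k"
  shows "\<exists>K::nat. K > 0 \<and>
           (\<forall>t \<in> incr_seqs k. t ! 0 > K \<longrightarrow>
              (\<exists>Y v0. Y \<subseteq> X \<and> is_star V E k t r Y v0 \<and> balanced V E origin Y))"
proof (rule ccontr)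
  assume no: "\<not> ?thesis"
  interpret rooted_tree q V E origin
    using assms by unfold_locales auto
  let ?good = "\<lambda>t. \<exists>Y v0. Y \<subseteq> X \<and> is_star V E k t r Y v0 \<and> balanced V E origin Y"
  have "\<exists>t \<in> incr_seqs k. t ! 0 > K \<and> \<not> ?good t" for K
  proof -
    \<comment> \<open>The negated claim concerns only positive bounds, so it is used at
      \<open>Suc K\<close>.\<close>
    have "\<exists>t \<in> incr_seqs k. t ! 0 > Suc K \<and> \<not> ?good t" using no by blast
    then show ?thesis using Suc_lessD by blast
  qed
  then obtain f where f: "\<And>K. f K \<in> incr_seqs k" "\<And>K. f K ! 0 > K" "\<And>K. \<not> ?good (f K)"
    by metis
  have fK: "set (f K) \<subseteq> {K<..f K ! (k - 1)}" "card (set (f K)) \<le> k" for K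
  proof -
    have len: "length (f K) = k" and srt: "sorted_wrt (<) (f K)"
      using f(1)[of K] by (auto simp: incr_seqs_def)
    show "card (set (f K)) \<le> k" using card_length[of "f K"] len by simp
    have le: "f K ! i \<le> f K ! j" if "i \<le> j" "j < k" for i j
      using srt that len by (cases "i = j") (auto simp: sorted_wrt_iff_nth_less order_less_imp_le)
    show "set (f K) \<subseteq> {K<..f K ! (k - 1)}"
    proof
      fix s assume "s \<in> set (f K)"
      then obtain i where i: "i < k" "s = f K ! i" using len by (auto simp: in_set_conv_nth)
      then show "s \<in> {K<..f K ! (k - 1)}" using le[of 0 i] le[of i "k - 1"] f(2)[of K] by auto
    qed
  qed

  \<comment> \<open>A real number strictly between 0 and the upper density; if the ratio were
    eventually at most \<open>\<delta>\<close>, so would be its limsup.\<close>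
  obtain \<delta> where \<delta>: "\<delta> > 0"
    and dense: "\<exists>\<^sub>F n in sequentially. \<delta> < real (card (X \<inter> S n)) / real (card (S n))"
  proof -
    obtain \<delta> where "0 < ereal \<delta>" "ereal \<delta> < upper_density V E origin X"
      using ereal_dense2[OF assms(5)] by blast
    moreover from this(2) have
      "\<exists>\<^sub>F n in sequentially. ereal \<delta> < ereal (real (card (X \<inter> S n)) / real (card (S n)))"
      unfolding upper_density_def frequently_def
      using Limsup_bounded[of "\<lambda>n. ereal (real (card (X \<inter> S n)) / real (card (S n)))" "ereal \<delta>" sequentially]
      by (auto simp: not_less)
    ultimately show ?thesis using that by simp
  qed

  let ?\<rho> = "1 - (1 - 1 / real q) ^ k"
  have "0 \<le> ?\<rho>" using q by (auto intro!: power_le_one)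
  moreover have "?\<rho> < 1" using q by auto
  \<comment> \<open>\<open>J\<close> blocks push the share of points that follow distinguished
    children below \<open>\<delta> / 2\<close>.\<close>
  ultimately obtain J where J: "?\<rho> ^ J < \<delta> / 2"
    using real_arch_pow_inv[of "\<delta> / 2" ?\<rho>] \<delta> by auto
  \<comment> \<open>A branch of \<open>R\<close> points suffices for every entry of
    \<open>r\<close>; inserting 1 keeps \<open>R\<close> positive for the division below.\<close>
  define R where "R = Max (insert 1 (set r))"
  have R: "R \<ge> 1" "\<And>i. i < k \<Longrightarrow> r ! i \<le> R" using assms(7) by (auto simp: R_def)
  \<comment> \<open>Starting the blocks at height \<open>K\<close> pushes the share of points with
    light cones below \<open>\<delta> / 2\<close>.\<close>
  obtain K where K: "(1/2) ^ K < \<delta> / (4 * R)"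
    using real_arch_pow_inv[of "\<delta> / (4 * R)" "1/2"] \<delta> R(1) by auto
  \<comment> \<open>Blocks are chained: the bad sequence chosen beyond \<open>b i\<close> has its
    last entry at \<open>b (Suc i)\<close>, where the next block begins.\<close>
  define b where "b = rec_nat K (\<lambda>_ B. f B ! (k - 1))"
  have b0: "b 0 = K" and bS: "b (Suc i) = f (b i) ! (k - 1)" for i by (simp_all add: b_def)
  let ?T = "\<lambda>i. set (f (b i))"
  have mono: "b i \<le> b (Suc i)" for i
  proof -
    have "f (b i) ! 0 \<in> ?T i" using f(1)[of "b i"] assms(6) by (auto simp: incr_seqs_def)
    then show ?thesis using fK(1)[of "b i"] bS by fastforce
  qed
  obtain n where n: "b J < n" "\<delta> < real (card (X \<inter> S n)) / real (card (S n))"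
    using dense unfolding frequently_sequentially by (meson Suc_le_lessD)
  \<comment> \<open>If all branches at the entries of \<open>f (b i)\<close> had at least
    \<open>R\<close> points, they would yield a star for this bad sequence.\<close>
  have thin: "\<exists>s\<in>?T i. card (branch X n s x) < R" if x: "x \<in> X \<inter> S n" and i: "i < J" for x i
  proof (rule ccontr)
    assume *: "\<not> ?thesis"
    have len: "length (f (b i)) = k" using f(1)[of "b i"] by (auto simp: incr_seqs_def)
    have "?good (f (b i))"
    proof (rule star_from_branches[OF x f(1)])
      fix l assume l: "l < k"
      then have mem: "f (b i) ! l \<in> ?T i" using len by simp
      then have "R \<le> card (branch X n (f (b i) ! l) x)" using * by (meson not_le)
      then show "r ! l \<le> card (branch X n (f (b i) ! l) x)" using R(2)[OF l] by simp
      have "b (Suc i) \<le> b J" using lift_Suc_mono_le[of b "Suc i" J] mono i by simp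
      then show "f (b i) ! l \<le> n" using mem fK(1)[of "b i"] bS[of i] n(1) by fastforce
    qed
    then show False using f(3) by blast
  qed
  have "card (X \<inter> S n) \<le> (?\<rho> ^ J + 2 * R * (1/2) ^ b 0) * card (S n)"
    by (rule card_thin_le[where T = ?T, OF mono n(1) _ _ thin]) (simp_all only: fK bS)
  moreover have "?\<rho> ^ J + 2 * R * (1/2) ^ b 0 < \<delta>"
  proof -
    have "2 * R * (1/2) ^ b 0 < \<delta> / 2" using K R(1) by (simp add: b0 field_simps)
    then show ?thesis using J by linarith
  qed
  \<comment> \<open>Division by zero gives 0, so an empty sphere could not have ratio above
    \<open>\<delta>\<close>.\<close>
  moreover have "card (S n) > 0" using n(2) \<delta> by (cases "card (S n) = 0") auto
  ultimately have "card (X \<inter> S n) < \<delta> * card (S n)"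
    by (smt (verit) mult_strict_right_mono of_nat_0_less_iff)
  then show False using n(2) \<open>card (S n) > 0\<close> by (simp add: field_simps)
qed

end
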